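(* Let $(\mathbf{u},\mathbf{v},\boldsymbol{\kappa})=(u_\lambda,v_\lambda,\kappa_\lambda)_{\lambda\in\Lambda}$ be a diagonal frame decomposition (DFD) of the bounded linear operator $\mathbf{K}:X\to Y$ such that $\mathbf{u}$ is minimal and $\inf_{\lambda\in\Lambda}\kappa_\lambda=0$. Let $\varphi$ satisfy Assumption A1 (stated in the context), let $E>0$, $\delta_0>0$, $\delta\in(0,\delta_0)$ and $\beta\in(0,1)$. For $\lambda\in\Lambda$ put $$D_{\lambda,\beta}=[\delta_\lambda^*,\beta^{-1}\delta_\lambda^*],\qquad \delta_\lambda^*=|\mathbf{v}|_{\inf}^{-1}E\sqrt{\kappa_\lambda^2\varphi(\kappa_\lambda^2)} .$$ If $\delta\in\bigcup_{\lambda\in\Lambda}D_{\lambda,\beta}$, then $$\inf_{\mathbf{R}}\Delta(\mathbf{M}_{\varphi,E},\delta,\mathbf{R})\ \ge\ \beta\,|\mathbf{u}|_{\sup}^{-1}\,E\sqrt{\Theta^{-1}\!\left(|\mathbf{v}|_{\inf}^2\,\delta^2/E^2\right)} .$$ In particular, if $(0,\delta_0]\subset\bigcup_{\lambda\in\Lambda}D_{\lambda,\beta}$, then this inequality holds for every $0<\delta\le\delta_0$.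
   Context: $X,Y$ are Hilbert spaces, $\mathbf{K}:X\to Y$ is a bounded linear operator, $\Lambda$ is an at most countable index set. Frames. Let $H$ be a closed subspace of a Hilbert space $\mathbb{K}$. A family $\mathbf{w}=(w_\lambda)_{\lambda\in\Lambda}$ in $H$ is a frame over $H$ if there are $0<A_w,B_w<\infty$ (frame bounds) with $A_w\|x\|^2\le\sum_\lambda|\langle x,w_\lambda\rangle|^2\le B_w\|x\|^2$ for all $x\in H$. It is minimal if $w_{\lambda_0}\notin\overline{\mathrm{span}}\{w_\lambda:\lambda\ne\lambda_0\}$ for every $\lambda_0\in\Lambda$. For $x\in\mathbb{K}$ put $\|x\|_w=(\sum_\lambda|\langle x,w_\lambda\rangle|^2)^{1/2}$, and $|\mathbf{w}|_{\inf}=\inf\{\|x\|_w:x\in H,\|x\|=1\}$, $|\mathbf{w}|_{\sup}=\sup\{\|x\|_w:x\in H,\|x\|=1\}$. DFD. $(u_\lambda,v_\lambda,\kappa_\lambda)_{\lambda\in\Lambda}$ is a DFD of $\mathbf{K}$ if $(u_\lambda)$ is a frame over $(\ker\mathbf{K})^\perp\subset X$, $(v_\lambda)$ is a frame over $\overline{\mathrm{ran}\,\mathbf{K}}\subset Y$, $\kappa_\lambda\in(0,\infty)$ and $\mathbf{K}^*v_\lambda=\kappa_\lambda u_\lambda$ for all $\lambda$. Index function. $a^*$ is an extended real number with $a^*>\sup_\lambda\kappa_\lambda^2$ if this supremum is finite, and $a^*=\infty$ otherwise. Assumption A1: $\varphi:(0,a^* )\to(0,\infty)$ is continuous, $\lim_{\mu\to0}\varphi(\mu)=0$,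 $\varphi$ is strictly increasing, and, with $\varphi(a^* ):=\lim_{\mu\to a^{*-}}\varphi(\mu)$, the function $\Theta:(0,\varphi(a^* )]\to(0,a^*\varphi(a^* )]$, $\Theta(\mu)=\mu\,\varphi^{-1}(\mu)$, is convex (endpoints omitted when infinite). Whenever $\Theta^{-1}(t)$ is written, $t$ is understood to lie in the range of $\Theta$. Source set: $\mathbf{M}_{\varphi,E}=\{x\in X:\sum_{\lambda}[\varphi(\kappa_\lambda^2)]^{-1}|\langle x,u_\lambda\rangle|^2\le E^2\}$. Worst-case error: for an arbitrary map $\mathbf{R}:Y\to X$, $\Delta(\mathbf{M},\delta,\mathbf{R})=\sup\{\|\mathbf{R}y^\delta-x^\ddagger\|:x^\ddagger\in\mathbf{M},\ y^\delta\in Y,\ \|\mathbf{K}x^\ddagger-y^\delta\|\le\delta\}$, where $x^\ddagger$ ranges over Moore–Penrose (minimum-norm) solutions, i.e. $x^\ddagger\in\mathbf{M}\cap(\ker\mathbf{K})^\perp$. The infimum is over all maps $\mathbf{R}:Y\to X$. *)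

theory Defs
  imports "HOL-Analysis.Analysis"
begin

section \<open>Hilbert spaces over the real or complex numbers\<close>

text \<open>
  A class for the two scalar fields \<open>real\<close> (with the identity) and \<open>complex\<close> (with complex
  conjugation).  By the theorem of Gelfand and Mazur these are, up to isomorphism, the only
  real normed fields with multiplicative norm, and the last axiom determines the conjugation.
\<close>

class rc_field = real_normed_field +
  fixes rc_conj :: "'a \<Rightarrow> 'a"
  assumes rc_conj_add: "rc_conj (a + b) = rc_conj a + rc_conj b"
    and rc_conj_mult_self: "rc_conj a * a = ((norm a)\<^sup>2) *\<^sub>R 1"

instantiation real :: rc_field
begin
definition "rc_conj (a :: real) = a"
instance by standard (auto simp: rc_conj_real_def power2_eq_square)
end

instantiation complex :: rc_field
begin
definition "rc_conj (a :: complex) = cnj a"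
instance
proof
  fix a b :: complex
  show "rc_conj (a + b) = rc_conj a + rc_conj b"
    by (simp add: rc_conj_complex_def)
  show "rc_conj a * a = ((norm a)\<^sup>2) *\<^sub>R 1"
    unfolding rc_conj_complex_def scaleR_conv_of_real complex_norm_square
    by (simp add: mult.commute)
qed
end

text \<open>
  The norm, topology and completeness of a Hilbert space come from the class \<open>banach\<close>; the scalar
  multiplication \<open>smul\<close> and the inner product \<open>ip\<close> (linear in the first argument) are parameters,
  so that the scalar field can be either of the two above.
\<close>

locale hilbert_space = vector_space smul
  for smul :: "'k::rc_field \<Rightarrow> 'a::banach \<Rightarrow> 'a" +
  fixes ip :: "'a \<Rightarrow> 'a \<Rightarrow> 'k"
  assumes smul_of_real: "smul (of_real r) x = r *\<^sub>R x"
    and ip_add_left: "ip (x + y) z = ip x z + ip y z"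
    and ip_smul_left: "ip (smul c x) y = c * ip x y"
    and ip_commute: "ip y x = rc_conj (ip x y)"
    and ip_self: "ip x x = of_real ((norm x)\<^sup>2)"

text \<open>Every real Hilbert space of the library is an instance, and so is \<open>complex\<close> over itself.\<close>

lemma hilbert_space_real:
  "hilbert_space (scaleR :: real \<Rightarrow> 'a \<Rightarrow> 'a) (inner :: 'a::{real_inner, banach} \<Rightarrow> 'a \<Rightarrow> real)"
  by unfold_locales
    (auto simp: algebra_simps inner_commute rc_conj_real_def power2_norm_eq_inner)

lemma hilbert_space_complex:
  "hilbert_space ((*) :: complex \<Rightarrow> complex \<Rightarrow> complex) (\<lambda>x y. x * cnj y)"
  by unfold_locales
    (auto simp: algebra_simps rc_conj_complex_def scaleR_conv_of_real complex_norm_square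
          simp del: of_real_power)

definition orth_compl :: "('a \<Rightarrow> 'a \<Rightarrow> 'k::zero) \<Rightarrow> 'a set \<Rightarrow> 'a set" where
  "orth_compl ip S = {x. \<forall>z\<in>S. ip x z = 0}"

definition ker :: "('a \<Rightarrow> 'b::zero) \<Rightarrow> 'a set" where
  "ker K = {x. K x = 0}"

definition hadjoint ::
  "('a \<Rightarrow> 'a \<Rightarrow> 'k) \<Rightarrow> ('b \<Rightarrow> 'b \<Rightarrow> 'k) \<Rightarrow> ('a \<Rightarrow> 'b) \<Rightarrow> 'b \<Rightarrow> 'a" where
  "hadjoint ipX ipY K = (THE K'. \<forall>x y. ipY (K x) y = ipX x (K' y))"


section \<open>Frames and diagonal frame decompositions\<close>

definition frame_over ::
  "('a \<Rightarrow> 'a \<Rightarrow> 'k::rc_field) \<Rightarrow> 'a::real_normed_vector set \<Rightarrow> 'i set \<Rightarrow> ('i \<Rightarrow> 'a) \<Rightarrow> bool" where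
  "frame_over ip H \<Lambda> w \<longleftrightarrow>
     (\<forall>l\<in>\<Lambda>. w l \<in> H) \<and>
     (\<exists>A>0. \<exists>B>0. \<forall>x\<in>H.
        (\<lambda>l. (norm (ip x (w l)))\<^sup>2) summable_on \<Lambda> \<and>
        A * (norm x)\<^sup>2 \<le> (\<Sum>\<^sub>\<infinity>l\<in>\<Lambda>. (norm (ip x (w l)))\<^sup>2) \<and>
        (\<Sum>\<^sub>\<infinity>l\<in>\<Lambda>. (norm (ip x (w l)))\<^sup>2) \<le> B * (norm x)\<^sup>2)"

definition minimal_family ::
  "('k::rc_field \<Rightarrow> 'a \<Rightarrow> 'a::real_normed_vector) \<Rightarrow> 'i set \<Rightarrow> ('i \<Rightarrow> 'a) \<Rightarrow> bool" where
  "minimal_family smul \<Lambda> w \<longleftrightarrow>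
     (\<forall>l\<^sub>0\<in>\<Lambda>. w l\<^sub>0 \<notin> closure (module.span smul {w l | l. l \<in> \<Lambda> \<and> l \<noteq> l\<^sub>0}))"

definition frame_norm ::
  "('a \<Rightarrow> 'a \<Rightarrow> 'k::rc_field) \<Rightarrow> 'i set \<Rightarrow> ('i \<Rightarrow> 'a) \<Rightarrow> 'a \<Rightarrow> real" where
  "frame_norm ip \<Lambda> w x = sqrt (\<Sum>\<^sub>\<infinity>l\<in>\<Lambda>. (norm (ip x (w l)))\<^sup>2)"

definition frame_inf ::
  "('a \<Rightarrow> 'a \<Rightarrow> 'k::rc_field) \<Rightarrow> 'a::real_normed_vector set \<Rightarrow> 'i set \<Rightarrow> ('i \<Rightarrow> 'a) \<Rightarrow> real" where
  "frame_inf ip H \<Lambda> w = Inf {frame_norm ip \<Lambda> w x | x. x \<in> H \<and> norm x = 1}"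

definition frame_sup ::
  "('a \<Rightarrow> 'a \<Rightarrow> 'k::rc_field) \<Rightarrow> 'a::real_normed_vector set \<Rightarrow> 'i set \<Rightarrow> ('i \<Rightarrow> 'a) \<Rightarrow> real" where
  "frame_sup ip H \<Lambda> w = Sup {frame_norm ip \<Lambda> w x | x. x \<in> H \<and> norm x = 1}"

definition dfd ::
  "('a \<Rightarrow> 'a \<Rightarrow> 'k::rc_field) \<Rightarrow> ('b \<Rightarrow> 'b \<Rightarrow> 'k) \<Rightarrow> ('a::real_normed_vector \<Rightarrow> 'b::real_normed_vector)
    \<Rightarrow> 'i set \<Rightarrow> ('i \<Rightarrow> 'a) \<Rightarrow> ('i \<Rightarrow> 'b) \<Rightarrow> ('i \<Rightarrow> real) \<Rightarrow> bool" where
  "dfd ipX ipY K \<Lambda> u v \<kappa> \<longleftrightarrow>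
     frame_over ipX (orth_compl ipX (ker K)) \<Lambda> u \<and>
     frame_over ipY (closure (range K)) \<Lambda> v \<and>
     (\<forall>l\<in>\<Lambda>. 0 < \<kappa> l \<and> hadjoint ipX ipY K (v l) = \<kappa> l *\<^sub>R u l)"


section \<open>Index functions\<close>

text \<open>
  The index function \<open>\<phi>\<close> is given on the interval \<open>(0, a)\<close>, where \<open>a\<close> is an extended real;
  its values outside are irrelevant.  \<open>index_end a \<phi>\<close> is \<open>\<phi>(a)\<close>, the limit from the left.
\<close>

definition index_end :: "ereal \<Rightarrow> (real \<Rightarrow> real) \<Rightarrow> ereal" where
  "index_end a \<phi> = Lim (at_left a) (\<lambda>s. ereal (\<phi> (real_of_ereal s)))"

text \<open>
  The extension of \<open>\<phi>\<close> to \<open>(0, a]\<close>, the endpoint being left out unless both \<open>a\<close> and \<open>\<phi>(a)\<close> are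
  finite.  Its inverse is defined on \<open>(0, \<phi>(a)]\<close>, again with the endpoint left out unless both
  are finite (if \<open>a\<close> is infinite, then \<open>\<Theta>\<close> would take the value \<open>\<infinity>\<close> at \<open>\<phi>(a)\<close>).
\<close>

definition index_dom :: "ereal \<Rightarrow> (real \<Rightarrow> real) \<Rightarrow> real set" where
  "index_dom a \<phi> = {\<mu>. 0 < \<mu> \<and> (ereal \<mu> < a \<or> ereal \<mu> = a \<and> index_end a \<phi> < \<infinity>)}"

definition index_ext :: "ereal \<Rightarrow> (real \<Rightarrow> real) \<Rightarrow> real \<Rightarrow> real" where
  "index_ext a \<phi> \<mu> = (if ereal \<mu> = a then real_of_ereal (index_end a \<phi>) else \<phi> \<mu>)"

definition Theta_dom :: "ereal \<Rightarrow> (real \<Rightarrow> real) \<Rightarrow> real set" where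
  "Theta_dom a \<phi> = {\<mu>. 0 < \<mu> \<and> (ereal \<mu> < index_end a \<phi> \<or> ereal \<mu> = index_end a \<phi> \<and> a < \<infinity>)}"

definition Theta :: "ereal \<Rightarrow> (real \<Rightarrow> real) \<Rightarrow> real \<Rightarrow> real" where
  "Theta a \<phi> \<mu> = \<mu> * inv_into (index_dom a \<phi>) (index_ext a \<phi>) \<mu>"

definition Theta_range :: "ereal \<Rightarrow> (real \<Rightarrow> real) \<Rightarrow> real set" where
  "Theta_range a \<phi> = Theta a \<phi> ` Theta_dom a \<phi>"

definition Theta_inv :: "ereal \<Rightarrow> (real \<Rightarrow> real) \<Rightarrow> real \<Rightarrow> real" where
  "Theta_inv a \<phi> = inv_into (Theta_dom a \<phi>) (Theta a \<phi>)"

definition admissible_end :: "'i set \<Rightarrow> ('i \<Rightarrow> real) \<Rightarrow> ereal \<Rightarrow> bool" where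
  "admissible_end \<Lambda> \<kappa> a \<longleftrightarrow>
     (if (SUP l\<in>\<Lambda>. ereal ((\<kappa> l)\<^sup>2)) < \<infinity> then (SUP l\<in>\<Lambda>. ereal ((\<kappa> l)\<^sup>2)) < a else a = \<infinity>)"

definition index_function :: "ereal \<Rightarrow> (real \<Rightarrow> real) \<Rightarrow> bool" where
  "index_function a \<phi> \<longleftrightarrow>
     (\<forall>\<mu>\<in>{\<mu>. 0 < \<mu> \<and> ereal \<mu> < a}. 0 < \<phi> \<mu>) \<and>
     continuous_on {\<mu>. 0 < \<mu> \<and> ereal \<mu> < a} \<phi> \<and>
     (\<phi> \<longlongrightarrow> 0) (at_right 0) \<and>
     strict_mono_on {\<mu>. 0 < \<mu> \<and> ereal \<mu> < a} \<phi> \<and>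
     convex_on (Theta_dom a \<phi>) (Theta a \<phi>)"


section \<open>Source sets and worst-case error\<close>

definition source_set ::
  "('a \<Rightarrow> 'a \<Rightarrow> 'k::rc_field) \<Rightarrow> 'i set \<Rightarrow> ('i \<Rightarrow> 'a) \<Rightarrow> ('i \<Rightarrow> real) \<Rightarrow> (real \<Rightarrow> real) \<Rightarrow> real \<Rightarrow> 'a set" where
  "source_set ip \<Lambda> u \<kappa> \<phi> E =
     {x. (\<lambda>l. inverse (\<phi> ((\<kappa> l)\<^sup>2)) * (norm (ip x (u l)))\<^sup>2) summable_on \<Lambda> \<and>
         (\<Sum>\<^sub>\<infinity>l\<in>\<Lambda>. inverse (\<phi> ((\<kappa> l)\<^sup>2)) * (norm (ip x (u l)))\<^sup>2) \<le> E\<^sup>2}"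

text \<open>The supremum is extended-real valued, since the error of an arbitrary map may be infinite.\<close>

definition worst_case_error ::
  "('a \<Rightarrow> 'a \<Rightarrow> 'k::rc_field) \<Rightarrow> ('a::real_normed_vector \<Rightarrow> 'b::real_normed_vector)
    \<Rightarrow> 'a set \<Rightarrow> real \<Rightarrow> ('b \<Rightarrow> 'a) \<Rightarrow> ereal" where
  "worst_case_error ip K M \<delta> R =
     Sup {ereal (norm (R y - x)) | x y.
            x \<in> M \<inter> orth_compl ip (ker K) \<and> norm (K x - y) \<le> \<delta>}"

definition delta_star :: "real \<Rightarrow> real \<Rightarrow> (real \<Rightarrow> real) \<Rightarrow> real \<Rightarrow> real" where
  "delta_star vinf E \<phi> k = inverse vinf * E * sqrt (k\<^sup>2 * \<phi> (k\<^sup>2))"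

definition D_interval :: "real \<Rightarrow> real \<Rightarrow> (real \<Rightarrow> real) \<Rightarrow> real \<Rightarrow> real \<Rightarrow> real set" where
  "D_interval vinf E \<phi> \<beta> k = {delta_star vinf E \<phi> k .. inverse \<beta> * delta_star vinf E \<phi> k}"

end

theory Submission
  imports Defs
begin

text \<open>
  Two elements \<open>x\<close> and \<open>-x\<close> of the source set whose images have norm at most \<open>\<delta>\<close> cannot be
  distinguished from the datum \<open>0\<close>: any map \<open>R\<close> returns the same point \<open>R 0\<close> for both, and that
  point is at distance at least \<open>norm x\<close> from one of them (\<open>worst_case_error_ge\<close>).  So it is
  enough to find one such \<open>x\<close> of large norm.

  Minimality of \<open>u\<close> provides it.  The residual of the orthogonal projection of \<open>u i\<close> onto the
  closed span of the other members of the family is a vector orthogonal to all \<open>u l\<close> except \<open>u i\<close>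
  (\<open>minimal_family_dual_vector\<close>).  Scale it such that its only nonzero coefficient has modulus
  \<open>E * sqrt (\<phi> k)\<close>, where \<open>k = (\<kappa> i)\<^sup>2\<close>; then the source condition holds with equality.
  The diagonal relation turns the coefficients of \<open>x\<close> into those of \<open>K x\<close>: the only nonzero one
  has modulus \<open>E * sqrt (k * \<phi> k)\<close>.  Comparing norms and frame norms on both sides gives
  \<open>norm (K x) \<le> \<delta>\<^sub>i\<close>, the left endpoint of the interval of \<open>i\<close>, and
  \<open>norm x \<ge> E * sqrt (\<phi> k) / uSup\<close>.

  It remains to compare \<open>\<phi> k\<close> with \<open>\<Theta>\<inverse> t\<close> for \<open>t = (vInf * \<delta> / E)\<^sup>2\<close>.
  That \<open>\<delta>\<close> lies left of the right endpoint of the interval means \<open>t \<le> k * \<phi> k / \<beta>\<^sup>2\<close>, that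
  is \<open>t \<le> \<Theta> (\<phi> k) / \<beta>\<^sup>2\<close>.  Since
  \<open>\<Theta> \<mu> / \<mu>\<close> is the value at \<open>\<mu>\<close> of the inverse of \<open>\<phi>\<close> and hence
  nondecreasing, this gives \<open>\<Theta>\<inverse> t \<le> \<phi> k / \<beta>\<^sup>2\<close> (\<open>Theta_inv_le\<close>).

  The adjoint is given by a definite description, so the diagonal relation says something about
  \<open>K\<close> only once an adjoint is known to exist.  Hence the projection theorem and the Riesz
  representation theorem are proved first, for both scalar fields at once.
\<close>

section \<open>The conjugation of the scalar field\<close>

text \<open>
  Only additivity is an axiom; but \<open>rc_conj a * a\<close>, being the squared norm, is multiplicative in
  \<open>a\<close>, and cancelling \<open>a\<close> shows that \<open>rc_conj\<close> is a multiplicative involution.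
\<close>

lemma rc_conj_0 [simp]: "rc_conj (0 :: 'k::rc_field) = 0"
  using rc_conj_add[of "0::'k" 0] by simp

lemma rc_conj_minus: "rc_conj (- a) = - rc_conj (a :: 'k::rc_field)"
  using rc_conj_add[of a "- a"] by (simp add: eq_neg_iff_add_eq_0 add.commute)

lemma rc_conj_self: "rc_conj a * a = of_real ((norm (a :: 'k::rc_field))\<^sup>2)"
  by (simp add: rc_conj_mult_self of_real_def)

lemma norm_rc_conj [simp]: "norm (rc_conj a) = norm (a :: 'k::rc_field)"
proof (cases "a = 0")
  case False
  have "norm (rc_conj a) * norm a = norm a * norm a"
    unfolding norm_mult[symmetric] rc_conj_self
    by (simp add: norm_mult power2_eq_square)
  then show ?thesis using False by simp
qed simp

lemma rc_conj_mult: "rc_conj (a * b) = rc_conj a * rc_conj (b :: 'k::rc_field)"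
proof (cases "a * b = 0")
  case False
  have "rc_conj (a * b) * (a * b) = (rc_conj a * a) * (rc_conj b * b)"
    unfolding rc_conj_self by (simp add: norm_mult power_mult_distrib)
  then have "rc_conj (a * b) * (a * b) = (rc_conj a * rc_conj b) * (a * b)"
    by (simp only: ac_simps)
  then show ?thesis using False by (meson mult_right_cancel)
qed auto

lemma rc_conj_of_real [simp]: "rc_conj (of_real r :: 'k::rc_field) = of_real r"
proof (cases "r = 0")
  case False
  have "rc_conj (of_real r) * of_real r = (of_real r * of_real r :: 'k)"
    unfolding rc_conj_self by (simp add: power2_eq_square)
  then show ?thesis using False by simp
qed simp

lemma rc_conj_rc_conj [simp]: "rc_conj (rc_conj a) = (a :: 'k::rc_field)"
proof (cases "a = 0")
  case False
  have "rc_conj (rc_conj a) * rc_conj a = a * rc_conj a"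
    using rc_conj_self[of a] rc_conj_self[of "rc_conj a"] by (simp add: mult.commute)
  moreover have "rc_conj a \<noteq> 0"
    using False norm_rc_conj[of a] by (metis norm_eq_zero)
  ultimately show ?thesis by simp
qed simp

section \<open>Projections and the Riesz representation theorem\<close>

context hilbert_space
begin

lemma ip_zero_left [simp]: "ip 0 z = 0"
  using ip_add_left[of 0 0 z] by simp

lemma ip_minus_left: "ip (- x) z = - ip x z"
  using ip_add_left[of x "- x" z] by (simp add: eq_neg_iff_add_eq_0 add.commute)

lemma ip_diff_left: "ip (x - y) z = ip x z - ip y z"
  using ip_add_left[of x "- y" z] by (simp add: ip_minus_left)

lemma ip_add_right: "ip z (x + y) = ip z x + ip z y"
  by (metis ip_add_left ip_commute rc_conj_add)

lemma ip_smul_right: "ip z (smul c x) = rc_conj c * ip z x"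
  by (metis ip_commute ip_smul_left rc_conj_mult)

lemma ip_minus_right: "ip z (- x) = - ip z x"
  by (metis ip_commute ip_minus_left rc_conj_minus)

lemma ip_diff_right: "ip z (x - y) = ip z x - ip z y"
  using ip_add_right[of z x "- y"] by (simp add: ip_minus_right)

lemma ip_zero_right [simp]: "ip z 0 = 0"
  by (metis ip_commute ip_zero_left rc_conj_0)

lemma ip_scaleR_left: "ip (r *\<^sub>R x) z = of_real r * ip x z"
  by (metis ip_smul_left smul_of_real)

lemma ip_scaleR_right: "ip z (r *\<^sub>R x) = of_real r * ip z x"
  by (metis ip_smul_right smul_of_real rc_conj_of_real)

lemma ip_eq_0_commute: "ip x y = 0 \<longleftrightarrow> ip y x = 0"
  by (metis ip_commute rc_conj_0)

lemma ip_self_eq_0 [simp]: "ip x x = 0 \<longleftrightarrow> x = 0"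
  by (simp add: ip_self)

lemma norm_smul: "norm (smul c x) = norm c * norm x"
proof -
  have "of_real ((norm (smul c x))\<^sup>2) = rc_conj c * c * ip x x"
    unfolding ip_self[symmetric] ip_smul_left ip_smul_right by simp
  also have "\<dots> = of_real ((norm c * norm x)\<^sup>2)"
    unfolding rc_conj_self ip_self by (simp add: power_mult_distrib)
  finally have "(norm (smul c x))\<^sup>2 = (norm c * norm x)\<^sup>2"
    by (simp only: of_real_eq_iff)
  then show ?thesis by simp
qed

lemma parallelogram:
  fixes x y :: 'a
  shows "(norm (x + y))\<^sup>2 + (norm (x - y))\<^sup>2 = 2 * (norm x)\<^sup>2 + 2 * (norm y)\<^sup>2"
proof -
  have "of_real ((norm (x + y))\<^sup>2 + (norm (x - y))\<^sup>2)
      = (of_real (2 * (norm x)\<^sup>2 + 2 * (norm y)\<^sup>2) :: 'k)"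
    unfolding of_real_add of_real_mult ip_self[symmetric]
    by (simp add: ip_add_left ip_add_right ip_diff_left ip_diff_right algebra_simps)
  then show ?thesis by (simp only: of_real_eq_iff)
qed

text \<open>
  The residual of the projection onto the line spanned by \<open>y\<close>.  Both the Cauchy-Schwarz
  inequality and the orthogonality of best approximations are read off from the right-hand side.
\<close>

lemma pythagoras_residual:
  assumes "y \<noteq> 0"
  shows "(norm (x - smul (ip x y / of_real ((norm y)\<^sup>2)) y))\<^sup>2
       = (norm x)\<^sup>2 - (norm (ip x y))\<^sup>2 / (norm y)\<^sup>2"
proof -
  define N where "N = (of_real ((norm y)\<^sup>2) :: 'k)"
  define c where "c = ip x y / N"
  have N: "N \<noteq> 0" "rc_conj N = N" using assms by (simp_all add: N_def del: of_real_power)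
  have cN: "c * N = ip x y" using N by (simp add: c_def)
  have "rc_conj c * N = rc_conj (ip x y)"
    unfolding cN[symmetric] rc_conj_mult N ..
  moreover have "c * rc_conj (ip x y) = of_real ((norm (ip x y))\<^sup>2) / N"
    unfolding rc_conj_self[symmetric] by (simp add: c_def mult.commute)
  ultimately have "ip (x - smul c y) (x - smul c y)
      = ip x x - of_real ((norm (ip x y))\<^sup>2) / N"
    using cN ip_self[of y, folded N_def]
    by (simp add: ip_diff_left ip_diff_right ip_smul_left ip_smul_right
        ip_commute[of x y] right_diff_distrib mult.left_commute)
  then have "of_real ((norm (x - smul c y))\<^sup>2)
      = (of_real ((norm x)\<^sup>2 - (norm (ip x y))\<^sup>2 / (norm y)\<^sup>2) :: 'k)"
    by (simp add: ip_self N_def)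
  then show ?thesis by (simp only: of_real_eq_iff c_def N_def)
qed

lemma cauchy_schwarz: "norm (ip x y) \<le> norm x * norm y"
proof (cases "y = 0")
  case False
  have "0 \<le> (norm x)\<^sup>2 - (norm (ip x y))\<^sup>2 / (norm y)\<^sup>2"
    unfolding pythagoras_residual[OF False, symmetric] by simp
  then have "(norm (ip x y))\<^sup>2 \<le> (norm x * norm y)\<^sup>2"
    using False by (simp add: field_simps)
  then show ?thesis by (rule power2_le_imp_le) simp
qed simp

lemma bounded_linear_ip_left: "bounded_linear (\<lambda>x. ip x z)"
proof (rule bounded_linear_intro[of _ "norm z"])
  show "ip (r *\<^sub>R x) z = r *\<^sub>R ip x z" for r x
    by (simp add: ip_scaleR_left scaleR_conv_of_real)
qed (auto simp: ip_add_left cauchy_schwarz)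

lemma subspace_scaleR: "subspace V \<Longrightarrow> x \<in> V \<Longrightarrow> r *\<^sub>R x \<in> V"
  by (metis smul_of_real subspace_scale)

text \<open>
  Otherwise moving from \<open>p\<close> in the direction \<open>y\<close> would lead closer to \<open>z\<close>.
\<close>

lemma orthogonal_of_nearest:
  assumes V: "subspace V" and p: "p \<in> V"
    and min: "\<And>y. y \<in> V \<Longrightarrow> norm (z - p) \<le> norm (z - y)" and y: "y \<in> V"
  shows "ip (z - p) y = 0"
proof (cases "y = 0")
  case False
  let ?c = "ip (z - p) y / of_real ((norm y)\<^sup>2)"
  have "norm (z - p) \<le> norm (z - (p + smul ?c y))"
    using V p y by (intro min subspace_add subspace_scale)
  then have "(norm (z - p))\<^sup>2 \<le> (norm ((z - p) - smul ?c y))\<^sup>2"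
    by (simp add: algebra_simps)
  then have "(norm (ip (z - p) y))\<^sup>2 / (norm y)\<^sup>2 \<le> 0"
    unfolding pythagoras_residual[OF False] by simp
  then show ?thesis using False by (simp add: divide_le_0_iff)
qed simp

text \<open>
  A minimizing sequence is Cauchy, because the midpoint of two of its members is no better an
  approximation than the infimum and the parallelogram law then bounds their distance.
\<close>

lemma nearest_point_exists:
  assumes V: "subspace V" and "closed V"
  obtains p where "p \<in> V" "\<And>y. y \<in> V \<Longrightarrow> norm (z - p) \<le> norm (z - y)"
proof -
  define D where "D = (\<lambda>y. (norm (z - y))\<^sup>2) ` V"
  define d where "d = Inf D"
  have ne: "D \<noteq> {}" using subspace_0[OF V] by (auto simp: D_def)
  have bdd: "bdd_below D" by (auto simp: D_def intro!: bdd_belowI[of _ 0])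
  have d_le: "d \<le> (norm (z - y))\<^sup>2" if "y \<in> V" for y
    unfolding d_def using bdd that by (intro cInf_lower) (auto simp: D_def)
  have "\<exists>y\<in>V. (norm (z - y))\<^sup>2 < d + inverse (real (Suc n))" for n
    using cInf_lessD[OF ne, of "d + inverse (real (Suc n))"] by (auto simp: d_def D_def)
  then obtain f where f: "f n \<in> V" "(norm (z - f n))\<^sup>2 < d + inverse (real (Suc n))" for n
    by metis
  have close: "(norm (f m - f n))\<^sup>2 \<le> 2 * inverse (real (Suc m)) + 2 * inverse (real (Suc n))"
    for m n
  proof -
    have "d \<le> (norm (z - (1/2) *\<^sub>R (f m + f n)))\<^sup>2"
      using f V by (intro d_le subspace_scaleR subspace_add)
    also have "z - (1/2) *\<^sub>R (f m + f n) = (1/2) *\<^sub>R ((z - f m) + (z - f n))"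
      by (simp add: algebra_simps flip: scaleR_add_left)
    finally have "4 * d \<le> (norm ((z - f m) + (z - f n)))\<^sup>2"
      by (simp add: power_divide)
    moreover have "norm ((z - f m) - (z - f n)) = norm (f m - f n)"
      by (simp add: norm_minus_commute)
    ultimately show ?thesis
      using parallelogram[of "z - f m" "z - f n"] f(2)[of m] f(2)[of n] by simp
  qed
  have "Cauchy f"
  proof (rule metric_CauchyI)
    fix e :: real assume e: "0 < e"
    then obtain N where N: "inverse (real (Suc N)) < e\<^sup>2 / 4"
      using reals_Archimedean[of "e\<^sup>2 / 4"] by auto
    have small: "inverse (real (Suc n)) < e\<^sup>2 / 4" if "N \<le> n" for n
    proof -
      have "inverse (real (Suc n)) \<le> inverse (real (Suc N))"
        using that by (intro le_imp_inverse_le) auto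
      then show ?thesis using N by (rule le_less_trans)
    qed
    show "\<exists>M. \<forall>m\<ge>M. \<forall>n\<ge>M. dist (f m) (f n) < e"
    proof (intro exI allI impI)
      fix m n assume "N \<le> m" "N \<le> n"
      then have "(norm (f m - f n))\<^sup>2 < e\<^sup>2"
        using close[of m n] small[of m] small[of n] by linarith
      then show "dist (f m) (f n) < e"
        unfolding dist_norm using e by (rule power2_less_imp_less[OF _ less_imp_le])
    qed
  qed
  then obtain p where lim: "f \<longlonglongrightarrow> p" by (auto simp: Cauchy_convergent_iff convergent_def)
  have p: "p \<in> V" using closed_sequentially[OF \<open>closed V\<close> _ lim] f(1) by simp
  have "(\<lambda>n. (norm (z - f n))\<^sup>2) \<longlonglongrightarrow> (norm (z - p))\<^sup>2"
    using lim by (intro tendsto_intros)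
  moreover have "(\<lambda>n. d + inverse (real (Suc n))) \<longlonglongrightarrow> d + 0"
    by (intro tendsto_intros LIMSEQ_inverse_real_of_nat)
  ultimately have "(norm (z - p))\<^sup>2 \<le> d + 0"
    using f(2) by (intro LIMSEQ_le) (auto intro: less_imp_le)
  then have "norm (z - p) \<le> norm (z - y)" if "y \<in> V" for y
    using d_le[OF that] by (simp add: power2_le_imp_le)
  with p show ?thesis by (rule that)
qed

lemma orthogonal_decomposition:
  assumes "subspace V" "closed V"
  obtains p where "p \<in> V" "\<And>y. y \<in> V \<Longrightarrow> ip (z - p) y = 0"
proof -
  obtain p where p: "p \<in> V" "\<And>y. y \<in> V \<Longrightarrow> norm (z - p) \<le> norm (z - y)"
    by (rule nearest_point_exists[OF assms, where z = z]) (blast intro: that)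
  show ?thesis
    by (rule that[OF p(1)]) (rule orthogonal_of_nearest[OF assms(1) p])
qed

text \<open>
  A nonzero functional is determined by its value at one vector \<open>q\<close> orthogonal to its kernel,
  since every vector differs from a multiple of \<open>q\<close> by an element of the kernel.
\<close>

lemma riesz:
  assumes lin: "\<And>x y. f (x + y) = f x + f y" "\<And>c x. f (smul c x) = c * f x"
    and cont: "continuous_on UNIV f"
  obtains w where "\<And>x. f x = ip x w"
proof (cases "\<forall>x. f x = 0")
  case True
  then show ?thesis using that[of 0] by simp
next
  case False
  then obtain z where z: "f z \<noteq> 0" by blast
  have f0: "f 0 = 0" using lin(1)[of 0 0] by simp
  have fdiff: "f (x - y) = f x - f y" for x y
    using lin(1)[of "x - y" y] by simp
  define N where "N = {x. f x = 0}"
  have "subspace N" by (rule subspaceI) (auto simp: N_def lin f0)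
  moreover have "closed N"
    unfolding N_def using cont by (intro closed_Collect_eq) auto
  ultimately obtain p where p: "p \<in> N" "\<And>y. y \<in> N \<Longrightarrow> ip (z - p) y = 0"
    by (rule orthogonal_decomposition[where z = z]) (blast intro: that)
  define q where "q = z - p"
  have fq: "f q \<noteq> 0" using p(1) z by (simp add: q_def fdiff N_def)
  then have q0: "ip q q \<noteq> 0" using f0 by auto
  (* The conjugate undoes the conjugate-linearity of the inner product in its second argument. *)
  define w where "w = smul (rc_conj (f q / ip q q)) q"
  have "f x = ip x w" for x
  proof -
    have "x - smul (f x / f q) q \<in> N" using fq by (simp add: N_def fdiff lin)
    then have "ip (x - smul (f x / f q) q) q = 0"
      using p(2) ip_eq_0_commute q_def by metis
    then have "ip x q = f x / f q * ip q q" by (simp add: ip_diff_left ip_smul_left)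
    then show ?thesis using fq q0 by (simp add: w_def ip_smul_right)
  qed
  then show ?thesis using that by blast
qed

lemma ip_right_unique: "(\<And>x. ip x y = ip x z) \<Longrightarrow> y = z"
  using ip_self_eq_0[of "y - z"] by (simp add: ip_diff_right)

lemma subspace_orth_compl: "subspace (orth_compl ip S)"
  by (rule subspaceI) (auto simp: orth_compl_def ip_add_left ip_smul_left)

lemma closed_orth_compl: "closed (orth_compl ip S)"
proof -
  have "orth_compl ip S = (\<Inter>z\<in>S. {x. ip x z = 0})" by (auto simp: orth_compl_def)
  moreover have "closed {x. ip x z = 0}" for z
    using bounded_linear_ip_left[of z]
    by (intro closed_Collect_eq) (auto intro: linear_continuous_on)
  ultimately show ?thesis by auto
qed

lemma subspace_closure:
  assumes V: "subspace V" shows "subspace (closure V)"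
proof (rule subspaceI)
  show "0 \<in> closure V" using subspace_0[OF V] closure_subset by blast
next
  fix x y assume "x \<in> closure V" "y \<in> closure V"
  then obtain f g where "\<And>n. f n \<in> V" "f \<longlonglongrightarrow> x" "\<And>n. g n \<in> V" "g \<longlonglongrightarrow> y"
    unfolding closure_sequential by blast
  then show "x + y \<in> closure V"
    unfolding closure_sequential
    using subspace_add[OF V] tendsto_add[of f x sequentially g y]
    by (intro exI[of _ "\<lambda>n. f n + g n"]) auto
next
  fix c x assume "x \<in> closure V"
  then obtain f where f: "\<And>n. f n \<in> V" "f \<longlonglongrightarrow> x"
    unfolding closure_sequential by blast
  have "bounded_linear (smul c)"
  proof (rule bounded_linear_intro[of _ "norm c"])
    show "smul c (r *\<^sub>R x) = r *\<^sub>R smul c x" for r x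
      by (metis smul_of_real scale_left_commute)
  qed (auto simp: scale_right_distrib norm_smul mult.commute)
  then have "(\<lambda>n. smul c (f n)) \<longlonglongrightarrow> smul c x"
    using f(2) by (rule bounded_linear.tendsto)
  then show "smul c x \<in> closure V"
    unfolding closure_sequential using f(1) subspace_scale[OF V]
    by (intro exI[of _ "\<lambda>n. smul c (f n)"]) auto
qed

section \<open>Minimal families and frames\<close>

text \<open>
  The residual of \<open>w i\<close> after projection onto the closed span of the other members; minimality
  says that it does not vanish.  It stays in \<open>H\<close>, which will be the orthogonal complement of the
  kernel, so that it is a minimum-norm solution.
\<close>

lemma minimal_family_dual_vector:
  assumes min: "minimal_family smul \<Lambda> w" and w: "\<And>l. l \<in> \<Lambda> \<Longrightarrow> w l \<in> H"
    and H: "subspace H" "closed H" and i: "i \<in> \<Lambda>"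
  obtains x where "x \<in> H" "ip x (w i) \<noteq> 0"
    "\<And>l. l \<in> \<Lambda> \<Longrightarrow> l \<noteq> i \<Longrightarrow> ip x (w l) = 0"
proof -
  let ?S = "{w l | l. l \<in> \<Lambda> \<and> l \<noteq> i}"
  let ?V = "closure (span ?S)"
  have V: "subspace ?V" "closed ?V" by (auto intro: subspace_closure)
  have "span ?S \<subseteq> H" using w H(1) by (intro span_minimal) auto
  then have VH: "?V \<subseteq> H" using H(2) by (rule closure_minimal)
  obtain p where p: "p \<in> ?V" "\<And>y. y \<in> ?V \<Longrightarrow> ip (w i - p) y = 0"
    by (rule orthogonal_decomposition[OF V, where z = "w i"]) (blast intro: that)
  have "w i \<notin> ?V" using min i by (auto simp: minimal_family_def)
  then have ne: "w i - p \<noteq> 0" using p(1) by auto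
  show ?thesis
  proof (rule that)
    show "w i - p \<in> H" using H(1) VH p(1) w[OF i] by (auto intro: subspace_diff)
    have "ip (w i - p) (w i) = ip (w i - p) (w i - p)"
      using p(2)[OF p(1)] by (simp only: ip_diff_right diff_zero)
    then show "ip (w i - p) (w i) \<noteq> 0" using ne by (metis ip_self_eq_0)
    show "ip (w i - p) (w l) = 0" if "l \<in> \<Lambda>" "l \<noteq> i" for l
      using that closure_subset[of "span ?S"] span_superset[of ?S] by (intro p(2)) blast
  qed
qed

lemma frame_norm_scaleR: "frame_norm ip \<Lambda> w (r *\<^sub>R x) = \<bar>r\<bar> * frame_norm ip \<Lambda> w x"
  by (simp add: frame_norm_def ip_scaleR_left norm_mult power_mult_distrib
      infsum_cmult_right' real_sqrt_mult)

text \<open>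
  The extremal values of the frame norm on the unit sphere of \<open>H\<close> bound it on all of \<open>H\<close>, by
  homogeneity.  The nonzero \<open>x\<close> also ensures that this sphere is not empty, without which the
  infimum and supremum would be unspecified.
\<close>

lemma frame_norm_bounds:
  assumes fr: "frame_over ip H \<Lambda> w" and H: "subspace H"
    and x: "x \<in> H" "x \<noteq> 0"
  shows "0 < frame_inf ip H \<Lambda> w" "frame_inf ip H \<Lambda> w * norm x \<le> frame_norm ip \<Lambda> w x"
    "0 < frame_sup ip H \<Lambda> w" "frame_norm ip \<Lambda> w x \<le> frame_sup ip H \<Lambda> w * norm x"
proof -
  let ?F = "{frame_norm ip \<Lambda> w x | x. x \<in> H \<and> norm x = 1}"
  from fr obtain A B where A: "0 < A" and AB: "\<forall>x\<in>H.
      (\<lambda>l. (norm (ip x (w l)))\<^sup>2) summable_on \<Lambda> \<and>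
      A * (norm x)\<^sup>2 \<le> (\<Sum>\<^sub>\<infinity>l\<in>\<Lambda>. (norm (ip x (w l)))\<^sup>2) \<and>
      (\<Sum>\<^sub>\<infinity>l\<in>\<Lambda>. (norm (ip x (w l)))\<^sup>2) \<le> B * (norm x)\<^sup>2"
    unfolding frame_over_def by (elim conjE exE) (rule that)
  have lo: "sqrt A \<le> t" and hi: "t \<le> sqrt B" if "t \<in> ?F" for t
  proof -
    from that obtain x where x: "t = frame_norm ip \<Lambda> w x" "x \<in> H" "norm x = 1" by auto
    show "sqrt A \<le> t" "t \<le> sqrt B" using bspec[OF AB x(2)] x by (simp_all add: frame_norm_def)
  qed
  have bdd: "bdd_below ?F" "bdd_above ?F"
    by (rule bdd_belowI[OF lo], assumption) (rule bdd_aboveI[OF hi])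
  let ?e = "inverse (norm x) *\<^sub>R x"
  have e: "frame_norm ip \<Lambda> w ?e \<in> ?F"
    using subspace_scaleR[OF H x(1)] x(2) by (intro CollectI exI[of _ ?e]) simp
  have eq: "frame_norm ip \<Lambda> w ?e = frame_norm ip \<Lambda> w x / norm x"
    by (simp add: frame_norm_scaleR divide_inverse_commute)
  have "sqrt A \<le> frame_inf ip H \<Lambda> w"
    unfolding frame_inf_def using e lo by (intro cInf_greatest) auto
  then show "0 < frame_inf ip H \<Lambda> w" by (rule less_le_trans[rotated]) (simp add: A)
  have "frame_inf ip H \<Lambda> w \<le> frame_norm ip \<Lambda> w ?e"
    unfolding frame_inf_def by (rule cInf_lower[OF e bdd(1)])
  then show "frame_inf ip H \<Lambda> w * norm x \<le> frame_norm ip \<Lambda> w x"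
    unfolding eq using x(2) by (simp add: field_simps)
  have sup: "frame_norm ip \<Lambda> w ?e \<le> frame_sup ip H \<Lambda> w"
    unfolding frame_sup_def by (rule cSup_upper[OF e bdd(2)])
  then show "frame_norm ip \<Lambda> w x \<le> frame_sup ip H \<Lambda> w * norm x"
    unfolding eq using x(2) by (simp add: field_simps)
  have "sqrt A \<le> frame_norm ip \<Lambda> w ?e" using lo e by blast
  then have "sqrt A \<le> frame_sup ip H \<Lambda> w" using sup by (rule order_trans)
  then show "0 < frame_sup ip H \<Lambda> w" by (rule less_le_trans[rotated]) (simp add: A)
qed

lemma frame_norm_single:
  assumes "i \<in> \<Lambda>" "\<And>l. l \<in> \<Lambda> \<Longrightarrow> l \<noteq> i \<Longrightarrow> ip x (w l) = 0"
  shows "frame_norm ip \<Lambda> w x = norm (ip x (w i))"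
proof -
  have "(\<Sum>\<^sub>\<infinity>l\<in>\<Lambda>. (norm (ip x (w l)))\<^sup>2) = (\<Sum>\<^sub>\<infinity>l\<in>{i}. (norm (ip x (w l)))\<^sup>2)"
    using assms by (intro infsum_cong_neutral) auto
  then show ?thesis by (simp add: frame_norm_def)
qed

end

section \<open>The worst-case error of a diagonal frame decomposition\<close>

lemma adjoint_identity:
  assumes X: "hilbert_space smX ipX" and Y: "hilbert_space smY ipY"
    and K: "Vector_Spaces.linear smX smY K" "bounded_linear K"
  shows "ipY (K x) y = ipX x (hadjoint ipX ipY K y)"
proof -
  interpret X: hilbert_space smX ipX by fact
  interpret Y: hilbert_space smY ipY by fact
  interpret K: Vector_Spaces.linear smX smY K by fact
  have "\<exists>w. \<forall>x. ipY (K x) y = ipX x w" for y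
  proof -
    have "continuous_on UNIV (\<lambda>x. ipY (K x) y)"
      using bounded_linear_compose[OF Y.bounded_linear_ip_left K(2)]
      by (rule linear_continuous_on)
    then show ?thesis
      using X.riesz[of "\<lambda>x. ipY (K x) y"]
      by (metis K.add K.scale Y.ip_add_left Y.ip_smul_left)
  qed
  then obtain K' where K': "\<forall>x y. ipY (K x) y = ipX x (K' y)" by metis
  then have "hadjoint ipX ipY K = K'"
    unfolding hadjoint_def by (intro the_equality) (auto intro!: ext X.ip_right_unique)
  then show ?thesis using K' by simp
qed

text \<open>
  Both \<open>x\<close> and \<open>-x\<close> are compatible with the datum \<open>0\<close>, and they are \<open>2 * norm x\<close> apart.
\<close>

lemma worst_case_error_ge:
  assumes K: "bounded_linear K"
    and x: "x \<in> M \<inter> orth_compl ip (ker K)" "- x \<in> M \<inter> orth_compl ip (ker K)"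
    and small: "norm (K x) \<le> \<delta>"
  shows "ereal (norm x) \<le> worst_case_error ip K M \<delta> R"
proof -
  have K_neg: "K (- x) = - K x" by (rule linear_neg[OF bounded_linear.linear[OF K]])
  have "ereal (norm (R 0 - x)) \<le> worst_case_error ip K M \<delta> R"
    unfolding worst_case_error_def using x small
    by (intro Sup_upper CollectI exI[of _ x] exI[of _ 0]) simp_all
  moreover have "ereal (norm (R 0 - (- x))) \<le> worst_case_error ip K M \<delta> R"
    unfolding worst_case_error_def using x small
    by (intro Sup_upper CollectI exI[of _ "- x"] exI[of _ 0]) (simp_all add: K_neg)
  moreover have "norm x \<le> max (norm (R 0 - x)) (norm (R 0 - (- x)))"
  proof -
    have "2 * norm x = norm ((R 0 - (- x)) - (R 0 - x))"
      by (simp flip: scaleR_2)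
    also have "\<dots> \<le> norm (R 0 - (- x)) + norm (R 0 - x)" by (rule norm_triangle_ineq4)
    finally show ?thesis by linarith
  qed
  ultimately show ?thesis
    by (metis (no_types) ereal_less_eq(3) max_def order_trans)
qed

text \<open>
  The element used is the vector dual to \<open>u i\<close>, scaled to the boundary of the source set.
  Because it has a single coefficient, its frame norm and that of its image are explicit.
\<close>

lemma dfd_worst_case_error_ge:
  assumes X: "hilbert_space smX ipX" and Y: "hilbert_space smY ipY"
    and K: "Vector_Spaces.linear smX smY K" "bounded_linear K"
    and dfd: "dfd ipX ipY K \<Lambda> u v \<kappa>" and min: "minimal_family smX \<Lambda> u"
    and i: "i \<in> \<Lambda>" and E: "0 < E" and pos: "0 < \<phi> ((\<kappa> i)\<^sup>2)"
    and \<delta>: "delta_star (frame_inf ipY (closure (range K)) \<Lambda> v) E \<phi> (\<kappa> i) \<le> \<delta>"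
  shows "0 < frame_inf ipY (closure (range K)) \<Lambda> v"
    "0 < frame_sup ipX (orth_compl ipX (ker K)) \<Lambda> u"
    "ereal (inverse (frame_sup ipX (orth_compl ipX (ker K)) \<Lambda> u) * E * sqrt (\<phi> ((\<kappa> i)\<^sup>2)))
      \<le> worst_case_error ipX K (source_set ipX \<Lambda> u \<kappa> \<phi> E) \<delta> R"
proof -
  interpret X: hilbert_space smX ipX by fact
  interpret Y: hilbert_space smY ipY by fact
  interpret K: Vector_Spaces.linear smX smY K by fact
  let ?H = "orth_compl ipX (ker K)" and ?G = "closure (range K)"
  let ?S = "frame_sup ipX ?H \<Lambda> u" and ?I = "frame_inf ipY ?G \<Lambda> v"
  let ?m = "E * sqrt (\<phi> ((\<kappa> i)\<^sup>2))"
  have fu: "frame_over ipX ?H \<Lambda> u" and fv: "frame_over ipY ?G \<Lambda> v"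
    and \<kappa>: "\<And>l. l \<in> \<Lambda> \<Longrightarrow> 0 < \<kappa> l" "\<And>l. l \<in> \<Lambda> \<Longrightarrow> hadjoint ipX ipY K (v l) = \<kappa> l *\<^sub>R u l"
    using dfd by (auto simp: dfd_def)
  have uH: "u l \<in> ?H" if "l \<in> \<Lambda>" for l using fu that by (auto simp: frame_over_def)
  have m: "0 < ?m" using E pos by simp
  obtain x0 where x0: "x0 \<in> ?H" "ipX x0 (u i) \<noteq> 0"
    "\<And>l. l \<in> \<Lambda> \<Longrightarrow> l \<noteq> i \<Longrightarrow> ipX x0 (u l) = 0"
    using X.minimal_family_dual_vector[OF min uH X.subspace_orth_compl X.closed_orth_compl i]
    by blast
  define x where "x = (?m / norm (ipX x0 (u i))) *\<^sub>R x0"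
  have xH: "x \<in> ?H"
    unfolding x_def using x0(1) by (intro X.subspace_scaleR X.subspace_orth_compl)
  have xi: "norm (ipX x (u i)) = ?m"
    unfolding x_def X.ip_scaleR_left norm_mult norm_of_real using x0(2) m by simp
  have x_ortho: "ipX x (u l) = 0" if "l \<in> \<Lambda>" "l \<noteq> i" for l
    using x0(3)[OF that] by (simp add: x_def X.ip_scaleR_left)
  have x_ne: "x \<noteq> 0" using xi m by auto
  have Kx: "ipY (K x) (v l) = of_real (\<kappa> l) * ipX x (u l)" if "l \<in> \<Lambda>" for l
    using adjoint_identity[OF X Y K] \<kappa>(2)[OF that] by (simp add: X.ip_scaleR_right)
  have Kx_ne: "K x \<noteq> 0" using Kx[OF i] xi m \<kappa>(1)[OF i] by auto
  have KxG: "K x \<in> ?G" using closure_subset[of "range K"] by auto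
  have G: "Y.subspace ?G"
    by (intro Y.subspace_closure K.subspace_image X.subspace_UNIV)
  note bv = Y.frame_norm_bounds[OF fv G KxG Kx_ne]
  note bu = X.frame_norm_bounds[OF fu X.subspace_orth_compl xH x_ne]
  show "0 < ?I" "0 < ?S" by (rule bv(1)) (rule bu(3))
  have "?I * norm (K x) \<le> \<kappa> i * ?m"
    using bv(2) Y.frame_norm_single[of i \<Lambda> "K x" v] i Kx xi x_ortho \<kappa>(1)[OF i]
    by (simp add: norm_mult)
  then have "norm (K x) \<le> inverse ?I * E * (\<kappa> i * sqrt (\<phi> ((\<kappa> i)\<^sup>2)))"
    using bv(1) by (simp add: field_simps)
  also have "\<kappa> i * sqrt (\<phi> ((\<kappa> i)\<^sup>2)) = sqrt ((\<kappa> i)\<^sup>2 * \<phi> ((\<kappa> i)\<^sup>2))"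
    using \<kappa>(1)[OF i] by (simp add: real_sqrt_mult)
  also have "inverse ?I * E * \<dots> \<le> \<delta>" using \<delta> by (simp add: delta_star_def)
  finally have Kx_le: "norm (K x) \<le> \<delta>" .
  have "frame_norm ipX \<Lambda> u x = ?m"
    using X.frame_norm_single[of i \<Lambda> x u] i x_ortho xi by simp
  then have norm_x: "inverse ?S * E * sqrt (\<phi> ((\<kappa> i)\<^sup>2)) \<le> norm x"
    using bu(3,4) by (simp add: field_simps)
  let ?f = "\<lambda>x l. inverse (\<phi> ((\<kappa> l)\<^sup>2)) * (norm (ipX x (u l)))\<^sup>2"
  have source: "(?f x has_sum E\<^sup>2) \<Lambda>"
  proof -
    have "?f x i = E\<^sup>2" using pos by (simp add: xi power_mult_distrib)
    then show ?thesis
      using i x_ortho by (intro has_sum_finite_neutralI[of "{i}"]) auto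
  qed
  have xM: "x \<in> source_set ipX \<Lambda> u \<kappa> \<phi> E"
    using source by (auto simp: source_set_def infsumI summable_on_def)
  then have "- x \<in> source_set ipX \<Lambda> u \<kappa> \<phi> E"
    by (simp add: source_set_def X.ip_minus_left)
  then have "ereal (norm x) \<le> worst_case_error ipX K (source_set ipX \<Lambda> u \<kappa> \<phi> E) \<delta> R"
    using xM xH X.subspace_neg[OF X.subspace_orth_compl xH] Kx_le K(2)
    by (intro worst_case_error_ge) auto
  with norm_x show "ereal (inverse ?S * E * sqrt (\<phi> ((\<kappa> i)\<^sup>2)))
      \<le> worst_case_error ipX K (source_set ipX \<Lambda> u \<kappa> \<phi> E) \<delta> R"
    by (meson ereal_less_eq(3) order_trans)
qed

section \<open>Inverting the index function\<close>

text \<open>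
  The left limit defining \<open>index_end\<close> exists because \<open>\<phi>\<close> is monotone.  As a supremum,
  it hands over a point of the interval at which \<open>\<phi>\<close> exceeds any given smaller number.
\<close>

lemma index_end_eq_SUP:
  assumes phi: "index_function a \<phi>" and a: "0 < a"
  shows "index_end a \<phi> = (SUP \<mu>\<in>{\<mu>. 0 < \<mu> \<and> ereal \<mu> < a}. ereal (\<phi> \<mu>))"
proof -
  let ?I = "{\<mu>. 0 < \<mu> \<and> ereal \<mu> < a}"
  let ?L = "SUP \<mu>\<in>?I. ereal (\<phi> \<mu>)"
  have mono: "\<phi> \<mu> \<le> \<phi> \<nu>" if "\<mu> \<in> ?I" "\<nu> \<in> ?I" "\<mu> \<le> \<nu>" for \<mu> \<nu>
  proof -
    have "strict_mono_on ?I \<phi>" using phi by (simp add: index_function_def)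
    then show ?thesis using that by (rule strict_mono_on_leD)
  qed
  have near: "eventually (\<lambda>s. s \<in> {max 0 b<..<a}) (at_left a)" if "b < a" for b
    using that a by (intro eventually_at_leftI[of "max 0 b"]) auto
  have real: "real_of_ereal s \<in> ?I" "ereal (real_of_ereal s) = s" if "0 < s" "s < a" for s
    using that by (cases s; force)+
  have "((\<lambda>s. ereal (\<phi> (real_of_ereal s))) \<longlongrightarrow> ?L) (at_left a)"
  proof (rule order_tendstoI)
    fix t assume "t < ?L"
    then obtain \<mu> where \<mu>: "\<mu> \<in> ?I" "t < ereal (\<phi> \<mu>)" unfolding less_SUP_iff by blast
    from \<mu>(1) have "eventually (\<lambda>s. s \<in> {max 0 (ereal \<mu>)<..<a}) (at_left a)" by (intro near) auto
    then show "eventually (\<lambda>s. t < ereal (\<phi> (real_of_ereal s))) (at_left a)"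
    proof eventually_elim
      case (elim s)
      then have s: "0 < s" "ereal \<mu> < s" "s < a" by auto
      then have "\<mu> \<le> real_of_ereal s" by (cases s) auto
      then have "\<phi> \<mu> \<le> \<phi> (real_of_ereal s)" using \<mu>(1) real s by (intro mono) auto
      then show ?case using \<mu>(2) by (meson ereal_less_eq(3) less_le_trans)
    qed
  next
    fix t assume t: "?L < t"
    have "eventually (\<lambda>s. s \<in> {max 0 0<..<a}) (at_left a)" using a by (rule near)
    then show "eventually (\<lambda>s. ereal (\<phi> (real_of_ereal s)) < t) (at_left a)"
    proof eventually_elim
      case (elim s)
      then have "real_of_ereal s \<in> ?I" using real by auto
      then have "ereal (\<phi> (real_of_ereal s)) \<le> ?L" by (rule SUP_upper)
      then show ?case using t by simp
    qed
  qed
  moreover have "at_left a \<noteq> bot"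
  proof
    assume "at_left a = bot"
    then have "eventually (\<lambda>_. False) (at_left a)" by simp
    then obtain b where "b < a" "\<forall>y>b. \<not> y < a"
      unfolding eventually_at_left[OF a] by blast
    then show False using dense[of b a] by blast
  qed
  ultimately show ?thesis unfolding index_end_def by (intro tendsto_Lim)
qed

text \<open>
  This makes \<open>inv_into\<close> in the definition of \<open>Theta\<close> a genuine right inverse.  Below the end value
  it is the intermediate value theorem, with the limit \<open>0\<close> at the origin providing small values;
  the end value itself is attained at the endpoint.
\<close>

lemma index_ext_surj:
  assumes phi: "index_function a \<phi>" and a: "0 < a" and s: "s \<in> Theta_dom a \<phi>"
  shows "s \<in> index_ext a \<phi> ` index_dom a \<phi>"
proof (cases "ereal s < index_end a \<phi>")
  case True
  let ?I = "{\<mu>. 0 < \<mu> \<and> ereal \<mu> < a}"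
  have "0 < s" using s by (auto simp: Theta_dom_def)
  from True obtain b where b: "0 < b" "ereal b < a" "s < \<phi> b"
    unfolding index_end_eq_SUP[OF phi a] less_SUP_iff by auto
  have "eventually (\<lambda>\<mu>. \<phi> \<mu> < s) (at_right 0)"
    using phi \<open>0 < s\<close> unfolding index_function_def by (blast intro: order_tendstoD)
  then obtain d where d: "0 < d" "\<And>\<mu>. 0 < \<mu> \<Longrightarrow> \<mu> < d \<Longrightarrow> \<phi> \<mu> < s"
    unfolding eventually_at_right_field by auto
  define c where "c = min (d / 2) b"
  have c: "0 < c" "c \<le> b" "c < d" using d(1) b(1) by (auto simp: c_def)
  then have "\<phi> c \<le> s" using d(2)[of c] by simp
  have "continuous_on {c..b} \<phi>"
  proof (rule continuous_on_subset)
    show "continuous_on ?I \<phi>" using phi by (simp add: index_function_def)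
    show "{c..b} \<subseteq> ?I" using c b by (auto intro: le_less_trans[of _ "ereal b"])
  qed
  then obtain p where p: "c \<le> p" "p \<le> b" "\<phi> p = s"
    using IVT'[of \<phi> c s b] \<open>\<phi> c \<le> s\<close> c(2) b(3) by auto
  have "ereal p < a" using p(2) b(2) by (meson ereal_less_eq(3) le_less_trans)
  then show ?thesis
    using p c by (intro image_eqI[of _ _ p]) (auto simp: index_ext_def index_dom_def)
next
  case False
  then have eq: "index_end a \<phi> = ereal s" and "a < \<infinity>" using s by (auto simp: Theta_dom_def)
  then obtain r where "a = ereal r" using a by (cases a) auto
  then show ?thesis
    using eq a by (intro image_eqI[of _ _ r]) (auto simp: index_ext_def index_dom_def)
qed

text \<open>
  If \<open>s = Theta_inv a \<phi> t\<close> exceeded \<open>\<gamma> * \<phi> k\<close>, it would exceed \<open>\<phi> k\<close>, so the preimage \<open>p\<close> of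
  \<open>s\<close> under \<open>\<phi>\<close> would be at least \<open>k\<close>, and \<open>t = s * p\<close> would be larger than
  \<open>\<gamma> * \<phi> k * k\<close>.
\<close>

lemma Theta_inv_le:
  assumes phi: "index_function a \<phi>" and k: "0 < k" "ereal k < a" and \<gamma>: "1 \<le> \<gamma>"
    and t: "t \<in> Theta_range a \<phi>" "t \<le> \<gamma> * (k * \<phi> k)"
  shows "Theta_inv a \<phi> t \<le> \<gamma> * \<phi> k"
proof (rule ccontr)
  define s where "s = Theta_inv a \<phi> t"
  define p where "p = inv_into (index_dom a \<phi>) (index_ext a \<phi>) s"
  assume "\<not> Theta_inv a \<phi> t \<le> \<gamma> * \<phi> k"
  then have large: "\<gamma> * \<phi> k < s" by (simp add: s_def)
  have "0 < ereal k" using k(1) by simp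
  then have a: "0 < a" using k(2) by (rule less_trans)
  have \<phi>k: "0 < \<phi> k" using phi k by (auto simp: index_function_def)
  have sdom: "s \<in> Theta_dom a \<phi>" and ts: "t = s * p"
    using t(1) f_inv_into_f[of t "Theta a \<phi>" "Theta_dom a \<phi>"]
    by (auto simp: s_def p_def Theta_inv_def Theta_range_def inv_into_into Theta_def)
  have p: "p \<in> index_dom a \<phi>" "index_ext a \<phi> p = s"
    using index_ext_surj[OF phi a sdom] by (auto simp: p_def inv_into_into f_inv_into_f)
  have "\<phi> k \<le> \<gamma> * \<phi> k" using \<gamma> \<phi>k by simp
  then have "\<phi> k < s" using large by simp
  have "k \<le> p"
  proof (cases "ereal p = a")
    case True
    then show ?thesis using k(2) by auto
  next
    case False
    then have "\<phi> p = s" "0 < p" "ereal p < a" using p by (auto simp: index_ext_def index_dom_def)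
    then show ?thesis
      using \<open>\<phi> k < s\<close> k phi strict_mono_on_less[of _ \<phi> p k]
      unfolding index_function_def by fastforce
  qed
  have "\<gamma> * (k * \<phi> k) = (\<gamma> * \<phi> k) * k" by simp
  also have "\<dots> < s * k" using large k(1) by simp
  also have "\<dots> \<le> s * p" using \<open>k \<le> p\<close> \<open>\<phi> k < s\<close> \<phi>k by simp
  finally show False using t(2) ts by simp
qed

section \<open>The lower bound\<close>

lemma admissible_end_greater:
  assumes "admissible_end \<Lambda> \<kappa> a" "l \<in> \<Lambda>"
  shows "ereal ((\<kappa> l)\<^sup>2) < a"
proof -
  have "ereal ((\<kappa> l)\<^sup>2) \<le> (SUP l\<in>\<Lambda>. ereal ((\<kappa> l)\<^sup>2))" using assms(2) by (rule SUP_upper)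
  then show ?thesis using assms(1) by (auto simp: admissible_end_def split: if_splits)
qed

theorem theorem3p3:
  fixes scaleX :: "'k::rc_field \<Rightarrow> 'x::banach \<Rightarrow> 'x" and ipX :: "'x \<Rightarrow> 'x \<Rightarrow> 'k"
    and scaleY :: "'k \<Rightarrow> 'y::banach \<Rightarrow> 'y" and ipY :: "'y \<Rightarrow> 'y \<Rightarrow> 'k"
    and K :: "'x \<Rightarrow> 'y"
    and \<Lambda> :: "'i set" and u :: "'i \<Rightarrow> 'x" and v :: "'i \<Rightarrow> 'y" and \<kappa> :: "'i \<Rightarrow> real"
    and a :: ereal and \<phi> :: "real \<Rightarrow> real" and E \<delta>\<^sub>0 \<beta> :: real
  assumes X: "hilbert_space scaleX ipX"
    and Y: "hilbert_space scaleY ipY"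
    and K_linear: "Vector_Spaces.linear scaleX scaleY K"
    and K_bounded: "bounded_linear K"
    and Lambda: "countable \<Lambda>"
    and dfd: "dfd ipX ipY K \<Lambda> u v \<kappa>"
    and minimal: "minimal_family scaleX \<Lambda> u"
    and inf_kappa: "(INF l\<in>\<Lambda>. ereal (\<kappa> l)) = 0"
    and a: "admissible_end \<Lambda> \<kappa> a"
    and phi: "index_function a \<phi>"
    and E: "0 < E" and delta0: "0 < \<delta>\<^sub>0" and beta: "0 < \<beta>" "\<beta> < 1"
  shows "let uSup = frame_sup ipX (orth_compl ipX (ker K)) \<Lambda> u;
             vInf = frame_inf ipY (closure (range K)) \<Lambda> v;
             D = (\<Union>l\<in>\<Lambda>. D_interval vInf E \<phi> \<beta> (\<kappa> l));
             M = source_set ipX \<Lambda> u \<kappa> \<phi> E;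
             lower_bound = (\<lambda>\<delta>.
               vInf\<^sup>2 * \<delta>\<^sup>2 / E\<^sup>2 \<in> Theta_range a \<phi> \<longrightarrow>
               (INF R. worst_case_error ipX K M \<delta> R) \<ge>
                 ereal (\<beta> * inverse uSup * E * sqrt (Theta_inv a \<phi> (vInf\<^sup>2 * \<delta>\<^sup>2 / E\<^sup>2))))
         in (\<forall>\<delta>. 0 < \<delta> \<and> \<delta> < \<delta>\<^sub>0 \<and> \<delta> \<in> D \<longrightarrow> lower_bound \<delta>) \<and>
            ({0<..\<delta>\<^sub>0} \<subseteq> D \<longrightarrow> (\<forall>\<delta>. 0 < \<delta> \<and> \<delta> \<le> \<delta>\<^sub>0 \<longrightarrow> lower_bound \<delta>))"
proof -
  define S where "S = frame_sup ipX (orth_compl ipX (ker K)) \<Lambda> u"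
  define I where "I = frame_inf ipY (closure (range K)) \<Lambda> v"
  define M where "M = source_set ipX \<Lambda> u \<kappa> \<phi> E"
  have key: "ereal (\<beta> * inverse S * E * sqrt (Theta_inv a \<phi> t)) \<le> worst_case_error ipX K M \<delta> R"
    if D: "\<delta> \<in> (\<Union>l\<in>\<Lambda>. D_interval I E \<phi> \<beta> (\<kappa> l))" and \<delta>: "0 < \<delta>"
      and t_def: "t = I\<^sup>2 * \<delta>\<^sup>2 / E\<^sup>2" and t: "t \<in> Theta_range a \<phi>" for \<delta> t R
  proof -
    from D obtain i where i: "i \<in> \<Lambda>" and lower: "delta_star I E \<phi> (\<kappa> i) \<le> \<delta>"
      and upper: "\<delta> \<le> inverse \<beta> * delta_star I E \<phi> (\<kappa> i)"
      by (auto simp: D_interval_def)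
    let ?k = "(\<kappa> i)\<^sup>2"
    have k: "0 < ?k" "ereal ?k < a"
      using dfd i admissible_end_greater[OF a i] by (auto simp: dfd_def)
    have pos: "0 < \<phi> ?k" using phi k by (auto simp: index_function_def)
    note bound = dfd_worst_case_error_ge[OF X Y K_linear K_bounded dfd minimal i E pos
        lower[unfolded I_def], folded S_def I_def M_def]
    (* The upper endpoint of the interval, rewritten as a bound on the argument of Theta_inv. *)
    have "I * \<delta> / E \<le> inverse \<beta> * sqrt (?k * \<phi> ?k)"
      using upper bound(1) E beta(1) by (simp add: delta_star_def field_simps)
    moreover have "0 \<le> I * \<delta> / E" using bound(1) \<delta> E by simp
    ultimately have "(I * \<delta> / E)\<^sup>2 \<le> (inverse \<beta> * sqrt (?k * \<phi> ?k))\<^sup>2" by (rule power_mono)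
    then have "t \<le> inverse (\<beta>\<^sup>2) * (?k * \<phi> ?k)"
      using k(1) pos by (simp add: t_def power_mult_distrib power_divide power_inverse)
    moreover have "1 \<le> inverse (\<beta>\<^sup>2)"
      using beta by (simp add: one_le_inverse power_le_one)
    ultimately have "Theta_inv a \<phi> t \<le> inverse (\<beta>\<^sup>2) * \<phi> ?k"
      using Theta_inv_le[OF phi k _ t] by blast
    then have "sqrt (Theta_inv a \<phi> t) \<le> sqrt (inverse (\<beta>\<^sup>2) * \<phi> ?k)" by simp
    also have "\<dots> = inverse \<beta> * sqrt (\<phi> ?k)"
      using beta by (simp add: real_sqrt_mult real_sqrt_inverse)
    finally have "\<beta> * sqrt (Theta_inv a \<phi> t) \<le> sqrt (\<phi> ?k)"
      using beta by (simp add: field_simps)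
    then have "(inverse S * E) * (\<beta> * sqrt (Theta_inv a \<phi> t)) \<le> (inverse S * E) * sqrt (\<phi> ?k)"
      using bound(2) E by (intro mult_left_mono) auto
    then have "\<beta> * inverse S * E * sqrt (Theta_inv a \<phi> t) \<le> inverse S * E * sqrt (\<phi> ?k)"
      by (simp add: ac_simps)
    then show ?thesis using bound(3) by (meson ereal_less_eq(3) order_trans)
  qed
  show ?thesis
    unfolding Let_def S_def[symmetric] I_def[symmetric] M_def[symmetric]
  proof (intro conjI impI allI)
    fix \<delta> assume "0 < \<delta> \<and> \<delta> < \<delta>\<^sub>0 \<and> \<delta> \<in> (\<Union>l\<in>\<Lambda>. D_interval I E \<phi> \<beta> (\<kappa> l))"
      and "I\<^sup>2 * \<delta>\<^sup>2 / E\<^sup>2 \<in> Theta_range a \<phi>"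
    then show "ereal (\<beta> * inverse S * E * sqrt (Theta_inv a \<phi> (I\<^sup>2 * \<delta>\<^sup>2 / E\<^sup>2)))
        \<le> (INF R. worst_case_error ipX K M \<delta> R)"
      by (intro INF_greatest key) auto
  next
    fix \<delta> assume "{0<..\<delta>\<^sub>0} \<subseteq> (\<Union>l\<in>\<Lambda>. D_interval I E \<phi> \<beta> (\<kappa> l))" "0 < \<delta> \<and> \<delta> \<le> \<delta>\<^sub>0"
      and "I\<^sup>2 * \<delta>\<^sup>2 / E\<^sup>2 \<in> Theta_range a \<phi>"
    then show "ereal (\<beta> * inverse S * E * sqrt (Theta_inv a \<phi> (I\<^sup>2 * \<delta>\<^sup>2 / E\<^sup>2)))
        \<le> (INF R. worst_case_error ipX K M \<delta> R)"
      by (intro INF_greatest key) auto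
  qed
qed

end
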